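(* Let $\epsilon>0$ and let $\ell$ be a positive integer. Then there exists a positive integer $k=k(\ell,\epsilon)$ such that the following holds for every positive integer $n$. Let $\mathcal{F}\subset 2^{[n]}$ be $k$-closed $(\mathrm{mod}\ \ell)$. Then there exists $X\subset [n]$ such that $|\mathcal{F}|_{X}|\geq 2^{-\epsilon n}|\mathcal{F}|$ and $\mathcal{F}|_{X}$ is a subfamily of an isomorphic copy of $S(|X|,\ell)$.
   Context: A family $\mathcal{F}\subset 2^{[n]}$ is $k$-closed $(\mathrm{mod}\ \ell)$ if for any $k$ not necessarily distinct sets $F_1,\dots,F_k\in\mathcal{F}$, the size $|F_1\cap\dots\cap F_k|$ is divisible by $\ell$. For $X\subset[n]$, $\mathcal{F}|_X=\{F\cap X: F\in\mathcal{F}\}$ is the projection of $\mathcal{F}$ onto $X$. For a finite ground set $Y$ with $|Y|=m$, $S(m,\ell)$ denotes the atomic family on $Y$ determined by disjoint sets $A_1,\dots,A_{\lfloor m/\ell\rfloor}\subset Y$ each of size exactly $\ell$: it consists of all sets $F\subset Y$ such that for every $i$ either $A_i\subset F$ or $A_i\cap F=\emptyset$, and $F\subset A_1\cup\dots\cup A_{\lfloor m/\ell\rfloor}$. An isomorphic copy of it is its image under a permutation of $Y$; thus "$\mathcal{F}|_X$ is a subfamily of an isomorphic copy of $S(|X|,\ell)$" means there are pairwise disjoint sets $A_1,\dots,A_{\lfloor |X|/\ell\rfloor}\subset X$ of size $\ell$ each such that every member of $\mathcal{F}|_X$ is a union of some of the $A_i$. *)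

theory Defs
  imports Complex_Main "HOL-Library.Disjoint_Sets" "HOL-Combinatorics.Permutations"
begin

(* The k sets are given as a function on {1..k}, so repetitions are allowed.  Only meaningful for
   k >= 1: for k = 0 the intersection is UNIV. *)
definition closed_mod :: "nat \<Rightarrow> nat \<Rightarrow> 'a set set \<Rightarrow> bool" where
  "closed_mod k l \<F> \<longleftrightarrow>
     (\<forall>F. (\<forall>i\<in>{1..k}. F i \<in> \<F>) \<longrightarrow> l dvd card (\<Inter>i\<in>{1..k}. F i))"

definition projection :: "'a set set \<Rightarrow> 'a set \<Rightarrow> 'a set set" where
  "projection \<F> X = {F \<inter> X | F. F \<in> \<F>}"

definition atomic_family :: "'a set \<Rightarrow> nat \<Rightarrow> (nat \<Rightarrow> 'a set) \<Rightarrow> 'a set set" where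
  "atomic_family Y d A =
     {F. F \<subseteq> Y \<and> (\<forall>i\<in>{1..d}. A i \<subseteq> F \<or> A i \<inter> F = {}) \<and> F \<subseteq> (\<Union>i\<in>{1..d}. A i)}"

(* is_S Y l \<S> says that \<S> is the family S(|Y|, l) on the finite ground set Y for some choice of the
   disjoint l-element sets A_1, ..., A_d, where d is the floor of |Y|/l.  The choice of the A_i is
   not fixed by Y, hence a predicate rather than a function. *)
definition is_S :: "'a set \<Rightarrow> nat \<Rightarrow> 'a set set \<Rightarrow> bool" where
  "is_S Y l \<S> \<longleftrightarrow>
     (\<exists>A. (\<forall>i\<in>{1..card Y div l}. A i \<subseteq> Y \<and> card (A i) = l) \<and>
          disjoint_family_on A {1..card Y div l} \<and>
          \<S> = atomic_family Y (card Y div l) A)"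

definition isomorphic_copy :: "'a set \<Rightarrow> 'a set set \<Rightarrow> 'a set set \<Rightarrow> bool" where
  "isomorphic_copy Y \<S> \<G> \<longleftrightarrow> (\<exists>p. p permutes Y \<and> \<G> = (\<lambda>F. p ` F) ` \<S>)"

end

theory Submission
  imports Defs "HOL-Number_Theory.Number_Theory"
begin

text \<open>
  Fix a prime power \<open>q = p ^ a\<close> exactly dividing \<open>l\<close>, and let \<open>V j\<close> be the span over the integers of the
  indicator functions of intersections of at most \<open>j\<close> members of \<open>\<F>\<close>.  By pigeonhole there is a bounded
  \<open>j\<close> such that modulo \<open>p\<close> the dimensions of \<open>V j\<close> and \<open>V (3 * j)\<close> differ by at most \<open>d = \<delta> n\<close>.  Let \<open>I\<close>
  be a set of \<open>dim (V j)\<close> points on which \<open>V j\<close> has a dual basis \<open>g i\<close>.  The products \<open>g i * g k\<close> and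
  \<open>g i * g i - g i\<close> lie in the space \<open>N\<close> of functions of \<open>V (2 * j)\<close> vanishing on \<open>I\<close>.  Off the support
  \<open>Y\<close> of \<open>N\<close> the \<open>g i\<close> are therefore indicators of disjoint sets, the atoms of \<open>\<F>\<close>.  On \<open>Y\<close> the space
  \<open>V j\<close> has dimension at most \<open>2 * d\<close>: some \<open>f\<close> in \<open>N\<close> is nonzero on half of any independent set
  in \<open>Y\<close>, and \<open>f * V j\<close> is contained in the small space of functions of \<open>V (3 * j)\<close> vanishing on \<open>I\<close>.
  If more than \<open>2 * d\<close> atoms outside \<open>Y\<close> had size not divisible by \<open>q\<close>, a nontrivial combination of the
  corresponding \<open>g i\<close> would vanish on \<open>Y\<close>; multiplied by one \<open>g i\<close> and raised to a suitable power it
  becomes, modulo \<open>q\<close>, the indicator of one such atom, whose size is then divisible by \<open>q\<close> because \<open>\<F>\<close>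
  is closed.  Hence \<open>\<F>\<close> has few traces on the union of the atoms of size not divisible by \<open>q\<close>.
  Deleting these atoms for all \<open>p\<close> leaves atoms of size divisible by \<open>l\<close>, which are cut into
  \<open>l\<close>-element sets.
\<close>

section \<open>Integer spans of indicators of intersections\<close>

text \<open>Values stay in the integers so that one function can be reduced modulo \<open>p\<close>
  for linear algebra and modulo \<open>p ^ a\<close> for counting.\<close>

inductive_set inter_span :: "'a set set \<Rightarrow> nat \<Rightarrow> ('a \<Rightarrow> int) set" for \<F> k where
  Inter: "\<lbrakk>S \<subseteq> \<F>; finite S; S \<noteq> {}; card S \<le> k\<rbrakk> \<Longrightarrow> (\<lambda>x. of_bool (x \<in> \<Inter>S)) \<in> inter_span \<F> k"
| zero: "(\<lambda>x. 0) \<in> inter_span \<F> k"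
| diff: "\<lbrakk>f \<in> inter_span \<F> k; g \<in> inter_span \<F> k\<rbrakk> \<Longrightarrow> (\<lambda>x. f x - g x) \<in> inter_span \<F> k"

definition additive_group :: "('a \<Rightarrow> int) set \<Rightarrow> bool" where
  "additive_group V \<longleftrightarrow> (\<lambda>x. 0) \<in> V \<and> (\<forall>f\<in>V. \<forall>g\<in>V. (\<lambda>x. f x - g x) \<in> V)"

lemma additive_group_diff:
  "\<lbrakk>additive_group V; f \<in> V; g \<in> V\<rbrakk> \<Longrightarrow> (\<lambda>x. f x - g x) \<in> V"
  by (auto simp: additive_group_def)

lemma additive_group_add:
  assumes "additive_group V" "f \<in> V" "g \<in> V"
  shows "(\<lambda>x. f x + g x) \<in> V"
proof -
  have "(\<lambda>x. 0 - g x) \<in> V"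
    using assms(1,3) additive_group_diff[of V "\<lambda>x. 0" g] by (simp add: additive_group_def)
  from additive_group_diff[OF assms(1,2) this] show ?thesis by simp
qed

lemma additive_group_scale:
  assumes "additive_group V" "f \<in> V"
  shows "(\<lambda>x. c * f x) \<in> V"
proof (induction c rule: int_induct[where k = 0])
  case base
  then show ?case using assms by (simp add: additive_group_def)
next
  case (step1 i)
  from additive_group_add[OF assms(1) this(2) assms(2)] show ?case by (simp add: algebra_simps)
next
  case (step2 i)
  from additive_group_diff[OF assms(1) this(2) assms(2)] show ?case by (simp add: algebra_simps)
qed

lemma additive_group_sum:
  assumes "additive_group V" "\<And>i. i \<in> A \<Longrightarrow> f i \<in> V"
  shows "(\<lambda>x. \<Sum>i\<in>A. f i x) \<in> V"
  using assms(2)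
proof (induction A rule: infinite_finite_induct)
  case (insert i A)
  then show ?case using additive_group_add[OF assms(1)] by simp
qed (use assms(1) in \<open>auto simp: additive_group_def\<close>)

lemma additive_group_inter_span: "additive_group (inter_span \<F> k)"
  by (auto simp: additive_group_def intro: inter_span.intros)

lemma inter_span_mono:
  assumes "j \<le> k"
  shows "inter_span \<F> j \<subseteq> inter_span \<F> k"
proof
  show "f \<in> inter_span \<F> k" if "f \<in> inter_span \<F> j" for f
    using that
  proof induction
    case (Inter S)
    then show ?case using assms by (intro inter_span.Inter) auto
  qed (auto intro: inter_span.zero inter_span.diff)
qed

text \<open>The indicators of \<open>\<Inter>S\<close> and \<open>\<Inter>T\<close> multiply to that
  of \<open>\<Inter>(S \<union> T)\<close>, so degrees add.\<close>

lemma inter_span_mult: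
  assumes "f \<in> inter_span \<F> j" "g \<in> inter_span \<F> k"
  shows "(\<lambda>x. f x * g x) \<in> inter_span \<F> (j + k)"
  using assms(1)
proof induction
  case (Inter S)
  show ?case
    using assms(2)
  proof induction
    case (Inter T)
    have "card (S \<union> T) \<le> j + k"
      using \<open>card S \<le> j\<close> Inter(4) card_Un_le[of S T] by linarith
    then have "(\<lambda>x. of_bool (x \<in> \<Inter>(S \<union> T))) \<in> inter_span \<F> (j + k)"
      using \<open>S \<subseteq> \<F>\<close> \<open>finite S\<close> \<open>S \<noteq> {}\<close> Inter by (intro inter_span.Inter) auto
    moreover have "(\<lambda>x. of_bool (x \<in> \<Inter>(S \<union> T)) :: int) =
        (\<lambda>x. of_bool (x \<in> \<Inter>S) * of_bool (x \<in> \<Inter>T))"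
      by (auto simp: fun_eq_iff)
    ultimately show ?case by simp
  next
    case (diff f g)
    from inter_span.diff[OF diff(3,4)] show ?case by (simp add: algebra_simps)
  qed (simp add: inter_span.zero)
next
  case (diff f g)
  from inter_span.diff[OF diff(3,4)] show ?case by (simp add: algebra_simps)
qed (simp add: inter_span.zero)

lemma inter_span_power:
  assumes "f \<in> inter_span \<F> j" "m > 0"
  shows "(\<lambda>x. f x ^ m) \<in> inter_span \<F> (j * m)"
  using assms(2)
proof (induction m rule: nat_induct_non_zero)
  case 1
  then show ?case using assms(1) by simp
next
  case (Suc m)
  from inter_span_mult[OF assms(1) Suc(2)] show ?case by simp
qed

lemma inter_span_member: "F \<in> \<F> \<Longrightarrow> (\<lambda>x. of_bool (x \<in> F)) \<in> inter_span \<F> 1"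
  using inter_span.Inter[of "{F}" \<F> 1] by simp

lemma inter_span_cong:
  assumes "f \<in> inter_span \<F> k" "\<And>F. F \<in> \<F> \<Longrightarrow> x \<in> F \<longleftrightarrow> y \<in> F"
  shows "f x = f y"
  using assms(1)
proof induction
  case (Inter S)
  then have "x \<in> \<Inter>S \<longleftrightarrow> y \<in> \<Inter>S" using assms(2) by blast
  then show ?case by simp
qed auto

section \<open>Closedness as divisibility of sums\<close>

lemma closed_mod_Inter:
  assumes "closed_mod k l \<F>" "S \<subseteq> \<F>" "finite S" "S \<noteq> {}" "card S \<le> k"
  shows "l dvd card (\<Inter>S)"
proof -
  obtain h where h: "bij_betw h {1..card S} S"
    using ex_bij_betw_nat_finite_1[OF assms(3)] by blast
  have pos: "card S \<ge> 1" using assms(3,4) by (simp add: Suc_leI card_gt_0_iff)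
  \<comment> \<open>Repeating \<open>h 1\<close> pads the at most \<open>k\<close> distinct sets to
    exactly \<open>k\<close>.\<close>
  define F where "F i = (if i \<le> card S then h i else h 1)" for i
  have "F ` {1..k} = S"
  proof
    show "F ` {1..k} \<subseteq> S"
      using pos by (auto simp: F_def intro!: bij_betwE[OF h, rule_format])
    have "h ` {1..card S} \<subseteq> F ` {1..k}"
      using assms(5) by (force simp: F_def)
    then show "S \<subseteq> F ` {1..k}" using bij_betw_imp_surj_on[OF h] by simp
  qed
  moreover from this have "\<forall>i\<in>{1..k}. F i \<in> \<F>" using assms(2) by blast
  ultimately show ?thesis using assms(1) unfolding closed_mod_def by metis
qed

lemma closed_mod_mono:
  assumes "closed_mod k l \<F>" "j \<le> k" "j > 0" "d dvd l"
  shows "closed_mod j d \<F>"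
  unfolding closed_mod_def
proof (intro allI impI)
  fix F assume F: "\<forall>i\<in>{1..j}. F i \<in> \<F>"
  have "card (F ` {1..j}) \<le> k"
    using card_image_le[of "{1..j}" F] assms(2) by simp
  then have "l dvd card (\<Inter>(F ` {1..j}))"
    using F assms by (intro closed_mod_Inter[OF assms(1)]) auto
  then show "d dvd card (\<Inter>(F ` {1..j}))" using assms(4) dvd_trans by blast
qed

text \<open>Summing an indicator over \<open>\<Omega>\<close> gives the size of an intersection, and
  divisibility passes to differences.\<close>

lemma closed_mod_dvd_sum:
  assumes "closed_mod k l \<F>" "\<F> \<subseteq> Pow \<Omega>" "finite \<Omega>" "f \<in> inter_span \<F> k"
  shows "int l dvd (\<Sum>x\<in>\<Omega>. f x)"
  using assms(4)
proof induction
  case (Inter S)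
  have "\<Inter>S \<subseteq> \<Omega>" using Inter assms(2) by blast
  then have "(\<Sum>x\<in>\<Omega>. of_bool (x \<in> \<Inter>S)) = int (card (\<Inter>S))"
    using assms(3) by (simp add: sum.If_cases of_bool_def Int_absorb1 flip: Inter_iff)
  then show ?case using closed_mod_Inter[OF assms(1) Inter] by simp
qed (auto simp: sum_subtractf)

section \<open>Independence and rank modulo a prime\<close>

text \<open>Over a prime \<open>p\<close> this says that \<open>V\<close> maps onto all of \<open>\<int>/p\<close>-valued functions on \<open>J\<close>;
  \<open>rank_on\<close> is the dimension of the reduction of \<open>V\<close> modulo \<open>p\<close> restricted to \<open>T\<close>.\<close>

definition indep_mod :: "int \<Rightarrow> ('a \<Rightarrow> int) set \<Rightarrow> 'a set \<Rightarrow> bool" where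
  "indep_mod p V J \<longleftrightarrow> (\<forall>j\<in>J. \<exists>g\<in>V. [g j = 1] (mod p) \<and> (\<forall>i\<in>J - {j}. p dvd g i))"

definition rank_on :: "int \<Rightarrow> ('a \<Rightarrow> int) set \<Rightarrow> 'a set \<Rightarrow> nat" where
  "rank_on p V T = Max (card ` {J. J \<subseteq> T \<and> indep_mod p V J})"

lemma indep_mod_subset: "\<lbrakk>indep_mod p V J; K \<subseteq> J; V \<subseteq> W\<rbrakk> \<Longrightarrow> indep_mod p W K"
  unfolding indep_mod_def by blast

lemma card_le_rank_on:
  assumes "finite T" "J \<subseteq> T" "indep_mod p V J"
  shows "card J \<le> rank_on p V T"
  unfolding rank_on_def using assms by (intro Max_ge) auto

lemma rank_on_mono:
  assumes "finite T" "V \<subseteq> W"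
  shows "rank_on p V T \<le> rank_on p W T"
proof -
  have "indep_mod p V {}" by (simp add: indep_mod_def)
  then have "rank_on p V T \<in> card ` {J. J \<subseteq> T \<and> indep_mod p V J}"
    unfolding rank_on_def using assms(1) by (intro Max_in) auto
  then show ?thesis
    using card_le_rank_on[OF assms(1)] indep_mod_subset[OF _ _ assms(2)] by auto
qed

lemma cong_inverse_prime:
  assumes "prime (p::int)" "\<not> p dvd a"
  obtains b where "[a * b = 1] (mod p)"
  using assms by (metis cong_solve_coprime_int coprime_commute prime_imp_coprime)

text \<open>Gaussian elimination: \<open>g\<close> scaled to 1 at \<open>y\<close> is the new dual
  function, and subtracting its multiples makes the old ones vanish at \<open>y\<close> without
  changing them modulo \<open>p\<close> on \<open>J\<close>.\<close>

lemma indep_mod_insert: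
  assumes p: "prime p" and V: "additive_group V" and J: "indep_mod p V J"
    and g: "g \<in> V" "\<forall>j\<in>J. p dvd g j" "\<not> p dvd g y"
  shows "indep_mod p V (insert y J)"
proof -
  obtain b where b: "[g y * b = 1] (mod p)" using cong_inverse_prime[OF p g(3)] .
  have bg: "(\<lambda>x. b * g x) \<in> V" using additive_group_scale[OF V g(1)] .
  show ?thesis
    unfolding indep_mod_def
  proof
    fix j assume j: "j \<in> insert y J"
    show "\<exists>g\<in>V. [g j = 1] (mod p) \<and> (\<forall>i\<in>insert y J - {j}. p dvd g i)"
    proof (cases "j = y")
      case True
      then show ?thesis using b g(2) by (intro bexI[OF _ bg]) (auto simp: mult.commute)
    next
      case False
      then have "j \<in> J" using j by simp
      then obtain f where f: "f \<in> V" "[f j = 1] (mod p)" "\<forall>i\<in>J - {j}. p dvd f i"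
        using J unfolding indep_mod_def by blast
      define f' where "f' x = f x - f y * (b * g x)" for x
      have "f' \<in> V"
        unfolding f'_def using additive_group_diff[OF V f(1) additive_group_scale[OF V bg]] .
      moreover have "[f' j = 1 - 0] (mod p)"
        unfolding f'_def using f(2) g(2) \<open>j \<in> J\<close> by (intro cong_diff) (auto simp: cong_0_iff)
      moreover have "p dvd f' i" if "i \<in> J - {j}" for i
        unfolding f'_def using f(3) g(2) that by auto
      moreover have "p dvd f' y"
      proof -
        have "f' y = - (f y * (g y * b - 1))" by (simp add: f'_def algebra_simps)
        then show ?thesis using b by (simp add: cong_iff_dvd_diff)
      qed
      ultimately show ?thesis by (intro bexI[of _ f']) auto
    qed
  qed
qed

text \<open>If some \<open>g\<close> in \<open>V\<close> vanished modulo \<open>p\<close> on a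
  largest \<open>J\<close> but not at \<open>y\<close>, \<open>indep_mod_insert\<close> would
  enlarge \<open>J\<close>. So modulo \<open>p\<close> the values on \<open>J\<close> determine
  those on \<open>T\<close>.\<close>

lemma maximal_indep_mod:
  assumes "prime p" "additive_group V" "finite T"
  obtains J where "J \<subseteq> T" "indep_mod p V J" "card J = rank_on p V T"
    "\<And>g y. \<lbrakk>g \<in> V; \<forall>j\<in>J. p dvd g j; y \<in> T\<rbrakk> \<Longrightarrow> p dvd g y"
proof -
  have "indep_mod p V {}" by (simp add: indep_mod_def)
  then have "rank_on p V T \<in> card ` {J. J \<subseteq> T \<and> indep_mod p V J}"
    unfolding rank_on_def using assms(3) by (intro Max_in) auto
  then obtain J where J: "J \<subseteq> T" "indep_mod p V J" "card J = rank_on p V T" by auto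
  have "p dvd g y" if g: "g \<in> V" "\<forall>j\<in>J. p dvd g j" "y \<in> T" for g y
  proof (rule ccontr)
    assume *: "\<not> p dvd g y"
    then have "y \<notin> J" using g by blast
    have "card (insert y J) \<le> rank_on p V T"
      using J g * by (intro card_le_rank_on[OF assms(3)] indep_mod_insert[OF assms(1,2)]) auto
    then show False
      using \<open>y \<notin> J\<close> J finite_subset[OF J(1) assms(3)] by simp
  qed
  then show thesis using that J by blast
qed

lemma exists_half_support:
  fixes p :: int
  assumes V: "additive_group V" and "finite J" and J: "\<And>y. y \<in> J \<Longrightarrow> \<exists>g\<in>V. \<not> p dvd g y"
  shows "\<exists>f\<in>V. card J \<le> 2 * card {y\<in>J. \<not> p dvd f y}"
proof (rule ccontr)
  assume contr: "\<not> ?thesis"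
  \<comment> \<open>A random subset sum of the \<open>g y\<close> is nonzero at a given point of \<open>J\<close> with probability at least 1/2.\<close>
  obtain g where g: "\<And>y. y \<in> J \<Longrightarrow> g y \<in> V" "\<And>y. y \<in> J \<Longrightarrow> \<not> p dvd g y y"
    using J by metis
  define s where "s A x = (\<Sum>y\<in>A. g y x)" for A x
  have fin: "finite (Pow J)" using \<open>finite J\<close> by simp
  have sV: "s A \<in> V" if "A \<in> Pow J" for A
    unfolding s_def using that g(1) by (intro additive_group_sum[OF V]) auto
  have "2 * card {y\<in>J. \<not> p dvd s A y} < card J" if "A \<in> Pow J" for A
    using contr sV[OF that] by (meson not_le)
  then have "(\<Sum>A\<in>Pow J. 2 * card {y\<in>J. \<not> p dvd s A y}) < (\<Sum>A\<in>Pow J. card J)"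
    using fin by (intro sum_strict_mono) auto
  moreover have "card (Pow J) \<le> 2 * card {A\<in>Pow J. \<not> p dvd s A y}" if y: "y \<in> J" for y
  proof -
    \<comment> \<open>Toggling \<open>y\<close> is an involution of \<open>Pow J\<close> that
      changes \<open>s A y\<close> by \<open>g y y\<close>, so at most one set of each pair has a
      sum divisible by \<open>p\<close> at \<open>y\<close>.\<close>
    define t where "t A = (if y \<in> A then A - {y} else insert y A)" for A
    have t: "t A \<in> Pow J" "t (t A) = A" if "A \<in> Pow J" for A
      using that y by (auto simp: t_def)
    have st: "\<not> p dvd s (t A) y" if "A \<in> Pow J" "p dvd s A y" for A
    proof (cases "y \<in> A")
      case True
      have "finite A" using that(1) \<open>finite J\<close> by (auto intro: finite_subset)
      then have "s A y = g y y + s (t A) y"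
        using True by (simp add: s_def t_def sum.remove[of A y])
      then show ?thesis using that(2) g(2)[OF y] by (metis dvd_add_left_iff)
    next
      case False
      have "finite A" using that(1) \<open>finite J\<close> by (auto intro: finite_subset)
      then have "s (t A) y = g y y + s A y"
        using False by (simp add: s_def t_def)
      then show ?thesis using that(2) g(2)[OF y] by (metis dvd_add_left_iff)
    qed
    have "card {A\<in>Pow J. p dvd s A y} \<le> card {A\<in>Pow J. \<not> p dvd s A y}"
      using t st fin by (intro card_inj_on_le[of t] inj_on_inverseI[of _ t]) auto
    moreover have "card (Pow J) = card {A\<in>Pow J. p dvd s A y} + card {A\<in>Pow J. \<not> p dvd s A y}"
      using fin by (subst card_Un_disjoint[symmetric]) (auto intro!: arg_cong[of _ _ card])
    ultimately show ?thesis by simp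
  qed
  then have "(\<Sum>y\<in>J. card (Pow J)) \<le> (\<Sum>y\<in>J. 2 * card {A\<in>Pow J. \<not> p dvd s A y})"
    by (rule sum_mono)
  moreover have "(\<Sum>y\<in>J. card {A\<in>Pow J. \<not> p dvd s A y}) = (\<Sum>A\<in>Pow J. card {y\<in>J. \<not> p dvd s A y})"
    by (rule sum_multicount_gen[symmetric]) (use fin \<open>finite J\<close> in auto)
  ultimately show False by (simp add: mult.commute flip: sum_distrib_left)
qed

text \<open>The restriction of \<open>V\<close> to \<open>T\<close> is determined by its restriction to \<open>rank_on p V T\<close> points.\<close>

lemma card_projection_le:
  fixes \<F> :: "'a set set"
  assumes "prime p" "finite T"
  shows "card (projection \<F> T) \<le> 2 ^ rank_on p (inter_span \<F> 1) T"
proof -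
  obtain J where J: "J \<subseteq> T" "card J = rank_on p (inter_span \<F> 1) T"
    and ker: "\<And>g y. \<lbrakk>g \<in> inter_span \<F> 1; \<forall>j\<in>J. p dvd g j; y \<in> T\<rbrakk> \<Longrightarrow> p dvd g y"
    using maximal_indep_mod[OF assms(1) additive_group_inter_span assms(2)] by metis
  have fin: "finite J" using J(1) assms(2) finite_subset by blast
  have p: "\<not> p dvd 1" "\<not> p dvd -1" using assms(1) by (auto simp: not_prime_unit)
  have "inj_on (\<lambda>A. A \<inter> J) (projection \<F> T)"
  proof (rule inj_onI)
    fix A B assume "A \<in> projection \<F> T" "B \<in> projection \<F> T" and eq: "A \<inter> J = B \<inter> J"
    then obtain F G where FG: "F \<in> \<F>" "G \<in> \<F>" "A = F \<inter> T" "B = G \<inter> T"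
      unfolding projection_def by blast
    \<comment> \<open>The difference of two indicators takes only the values -1, 0 and 1, so
      divisibility by \<open>p\<close> forces it to be 0.\<close>
    define h :: "'a \<Rightarrow> int" where "h x = of_bool (x \<in> F) - of_bool (x \<in> G)" for x
    have h: "h \<in> inter_span \<F> 1"
      unfolding h_def using FG by (intro inter_span.diff inter_span_member)
    have dvd: "p dvd h y" if "y \<in> T" for y
    proof (rule ker[OF h _ that])
      show "\<forall>j\<in>J. p dvd h j" using eq FG J(1) by (auto simp: h_def)
    qed
    have "y \<in> F \<longleftrightarrow> y \<in> G" if "y \<in> T" for y
      using p dvd[OF that] by (auto simp: h_def of_bool_def split: if_splits)
    then show "A = B" using FG by blast
  qed
  then have "card (projection \<F> T) \<le> card (Pow J)"
    by (rule card_inj_on_le) (use fin in auto)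
  then show ?thesis using J(2) fin by (simp add: card_Pow)
qed

section \<open>Rank on the support of functions vanishing on an independent set\<close>

text \<open>The functions dual to \<open>I\<close> may be nonzero on \<open>S\<close>; adjoining the
  points of \<open>S\<close> one at a time corrects them.\<close>

lemma indep_mod_Un:
  fixes p :: int
  assumes p: "prime p" and V: "additive_group V" and I: "indep_mod p V I" and "finite S"
    and S: "\<And>y. y \<in> S \<Longrightarrow> \<exists>g\<in>V. \<not> p dvd g y \<and> (\<forall>i\<in>I \<union> S - {y}. p dvd g i)"
    and "I \<inter> S = {}"
  shows "indep_mod p V (I \<union> S)"
proof -
  have "indep_mod p V (I \<union> R)" if "R \<subseteq> S" for R
    using finite_subset[OF that \<open>finite S\<close>] that
  proof (induction R)
    case (insert y R)
    then obtain g where g: "g \<in> V" "\<not> p dvd g y" "\<forall>i\<in>I \<union> S - {y}. p dvd g i"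
      using S[of y] by auto
    have "\<forall>i\<in>I \<union> R. p dvd g i" using g(3) insert \<open>I \<inter> S = {}\<close> by auto
    then have "indep_mod p V (insert y (I \<union> R))"
      using insert g by (intro indep_mod_insert[OF p V, of _ g]) auto
    then show ?case by simp
  qed (use I in simp)
  then show ?thesis by blast
qed

text \<open>Applied with \<open>V\<close>, \<open>N\<close>, \<open>U\<close> of degrees
  \<open>j\<close>, \<open>2 * j\<close>, \<open>3 * j\<close>. For \<open>J\<close> independent in
  the support, some \<open>f\<close> in \<open>N\<close> is nonzero on a set \<open>S\<close> of at
  least half of \<open>J\<close>. Multiplying the functions dual to \<open>S\<close> by
  \<open>f\<close> makes them vanish on \<open>I\<close>, so \<open>I \<union> S\<close> is
  independent for \<open>U\<close> and \<open>S\<close> has at most \<open>d\<close> points.\<close>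

lemma rank_on_support_le:
  fixes p :: int
  assumes p: "prime p" and V: "additive_group V" and U: "additive_group U" and N: "additive_group N"
    and "finite \<Omega>" "V \<subseteq> U" and I: "I \<subseteq> \<Omega>" "indep_mod p V I"
    and rank: "rank_on p U \<Omega> \<le> card I + d"
    and vanish: "\<And>f i. f \<in> N \<Longrightarrow> i \<in> I \<Longrightarrow> p dvd f i"
    and mult: "\<And>f g. f \<in> N \<Longrightarrow> g \<in> V \<Longrightarrow> (\<lambda>x. f x * g x) \<in> U"
  shows "rank_on p V {y\<in>\<Omega>. \<exists>f\<in>N. \<not> p dvd f y} \<le> 2 * d"
proof -
  let ?Y = "{y\<in>\<Omega>. \<exists>f\<in>N. \<not> p dvd f y}"
  have "finite ?Y" using \<open>finite \<Omega>\<close> by simp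
  obtain J where J: "J \<subseteq> ?Y" "indep_mod p V J" "card J = rank_on p V ?Y"
    by (rule maximal_indep_mod[OF p V \<open>finite ?Y\<close>])
  have "finite J" using J(1) \<open>finite ?Y\<close> finite_subset by blast
  have "\<exists>f\<in>N. card J \<le> 2 * card {y\<in>J. \<not> p dvd f y}"
    using J(1) by (intro exists_half_support[OF N \<open>finite J\<close>]) auto
  then obtain f where f: "f \<in> N" "card J \<le> 2 * card {y\<in>J. \<not> p dvd f y}" by blast
  define S where "S = {y\<in>J. \<not> p dvd f y}"
  have S: "finite S" "I \<inter> S = {}" "S \<subseteq> J"
    using \<open>finite J\<close> vanish[OF f(1)] by (auto simp: S_def)
  have "indep_mod p U (I \<union> S)"
  proof (rule indep_mod_Un[OF p U _ S(1) _ S(2)])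
    show "indep_mod p U I" using indep_mod_subset[OF I(2) order_refl \<open>V \<subseteq> U\<close>] .
    fix y assume "y \<in> S"
    then obtain g where g: "g \<in> V" "[g y = 1] (mod p)" "\<forall>i\<in>J - {y}. p dvd g i"
      using J(2) S(3) unfolding indep_mod_def by blast
    have "\<not> p dvd g y"
      using g(2) p by (metis cong_dvd_iff not_prime_unit)
    then have "\<not> p dvd f y * g y"
      using \<open>y \<in> S\<close> p by (auto simp: S_def prime_dvd_mult_iff)
    moreover have "\<forall>i\<in>I \<union> S - {y}. p dvd f i * g i"
    proof
      fix i assume "i \<in> I \<union> S - {y}"
      then have "p dvd f i \<or> p dvd g i" using g(3) S(3) vanish[OF f(1)] by blast
      then show "p dvd f i * g i" by auto
    qed
    ultimately show "\<exists>g\<in>U. \<not> p dvd g y \<and> (\<forall>i\<in>I \<union> S - {y}. p dvd g i)"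
      using mult[OF f(1) g(1)] by (intro bexI[of _ "\<lambda>x. f x * g x"]) auto
  qed
  moreover have "I \<union> S \<subseteq> \<Omega>" using I S(3) J(1) by auto
  ultimately have "card (I \<union> S) \<le> card I + d"
    using card_le_rank_on[OF \<open>finite \<Omega>\<close>] rank by (meson order_trans)
  moreover have "card (I \<union> S) = card I + card S"
    using S I(1) \<open>finite \<Omega>\<close> by (intro card_Un_disjoint) (auto intro: finite_subset)
  ultimately show ?thesis using f(2) J(3) unfolding S_def by simp
qed

section \<open>Dependent combinations and powers modulo a prime power\<close>

text \<open>Pigeonhole: there are more coefficient vectors on \<open>X\<close> than value vectors on
  \<open>J\<close> modulo \<open>p\<close>, so two of the former give the same values; their
  difference is the relation.\<close>

lemma exists_dependent_combination:
  fixes h :: "'b \<Rightarrow> 'a \<Rightarrow> int" and p :: int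
  assumes "p > 1" "finite X" "finite J" "card J < card X"
  obtains d x0 where "x0 \<in> X" "\<not> p dvd d x0" "\<And>y. y \<in> J \<Longrightarrow> p dvd (\<Sum>x\<in>X. d x * h x y)"
proof -
  define C where "C = X \<rightarrow>\<^sub>E {0..<p}"
  define \<phi> where "\<phi> c = restrict (\<lambda>y. (\<Sum>x\<in>X. c x * h x y) mod p) J" for c
  have "\<phi> ` C \<subseteq> J \<rightarrow>\<^sub>E {0..<p}"
    using \<open>p > 1\<close> by (auto simp: \<phi>_def)
  then have "card (\<phi> ` C) \<le> card (J \<rightarrow>\<^sub>E {0..<p})"
    using \<open>finite J\<close> by (intro card_mono finite_PiE) auto
  also have "\<dots> = nat p ^ card J" using \<open>finite J\<close> by (simp add: card_PiE)
  also have "\<dots> < nat p ^ card X" using assms by (intro power_strict_increasing) auto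
  also have "\<dots> = card C" using \<open>finite X\<close> by (simp add: C_def card_PiE)
  finally have "\<not> inj_on \<phi> C" by (rule pigeonhole)
  then obtain b c where bc: "b \<in> C" "c \<in> C" "b \<noteq> c" "\<phi> b = \<phi> c" by (auto simp: inj_on_def)
  then obtain x0 where x0: "x0 \<in> X" "b x0 \<noteq> c x0" unfolding C_def by (metis PiE_ext)
  show thesis
  proof
    show "x0 \<in> X" by fact
    have "b x0 \<in> {0..<p}" "c x0 \<in> {0..<p}" using bc x0 unfolding C_def by (auto dest: PiE_mem)
    then have "\<bar>b x0 - c x0\<bar> < p" by auto
    then show "\<not> p dvd b x0 - c x0"
      using x0(2) by (metis abs_dvd_iff dvd_abs_iff eq_iff_diff_eq_0 not_less zdvd_imp_le zero_less_abs_iff)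
    show "p dvd (\<Sum>x\<in>X. (b x - c x) * h x y)" if "y \<in> J" for y
    proof -
      have "\<phi> b y = \<phi> c y" using bc(4) by simp
      then have "p dvd (\<Sum>x\<in>X. b x * h x y) - (\<Sum>x\<in>X. c x * h x y)"
        using that by (simp add: \<phi>_def mod_eq_dvd_iff)
      then show ?thesis by (simp add: sum_subtractf left_diff_distrib)
    qed
  qed
qed

text \<open>The exponent is at least \<open>a\<close>, which kills multiples of \<open>p\<close>,
  and a multiple of the totient, which sends units to 1 by Euler's theorem.\<close>

lemma power_totient_cong:
  fixes u :: int
  assumes "prime p" "a > 0" "M = a * totient (p ^ a)"
  shows "[u ^ M = of_bool (\<not> int p dvd u)] (mod int p ^ a)"
proof (cases "int p dvd u")
  case True
  have "a \<le> M" using assms prime_gt_0_nat[of p] by (simp add: Suc_leI)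
  then have "int p ^ a dvd u ^ M"
    using True by (meson dvd_power_same dvd_trans le_imp_power_dvd)
  then show ?thesis using True by (simp add: cong_0_iff)
next
  case False
  have pa: "[int (nat (u mod int p ^ a)) = u] (mod int p ^ a)"
    using assms prime_gt_0_nat[of p] by (simp add: cong_def)
  have "coprime u (int p ^ a)"
    using prime_imp_coprime[of "int p" u] False assms(1) by (simp add: coprime_commute)
  then have "coprime (int (nat (u mod int p ^ a))) (int p ^ a)"
    using pa by (metis cong_imp_coprime cong_sym)
  then have "coprime (nat (u mod int p ^ a)) (p ^ a)"
    by (metis coprime_int_iff of_nat_power)
  then have "[nat (u mod int p ^ a) ^ totient (p ^ a) = 1] (mod p ^ a)" by (rule euler_theorem)
  then have "[int (nat (u mod int p ^ a)) ^ totient (p ^ a) = 1] (mod int p ^ a)"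
    by (metis cong_int_iff of_nat_1 of_nat_power)
  then have "[u ^ totient (p ^ a) = 1] (mod int p ^ a)"
    using cong_pow[OF pa] cong_sym cong_trans by blast
  then have "[(u ^ totient (p ^ a)) ^ a = 1 ^ a] (mod int p ^ a)" by (rule cong_pow)
  then show ?thesis using False assms(3) by (simp add: mult.commute flip: power_mult)
qed

section \<open>Rank on atoms of bad size\<close>

text \<open>Points in no member are left out: their number is subject to no divisibility.\<close>

definition atom :: "'a set set \<Rightarrow> 'a \<Rightarrow> 'a set" where
  "atom \<F> x = {y \<in> \<Union>\<F>. \<forall>F\<in>\<F>. x \<in> F \<longleftrightarrow> y \<in> F}"

definition bad_points :: "'a set set \<Rightarrow> nat \<Rightarrow> 'a set" where
  "bad_points \<F> m = {x \<in> \<Union>\<F>. \<not> m dvd card (atom \<F> x)}"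

text \<open>The bound is \<open>2 * d + 2 * d\<close>: an independent set \<open>J\<close> of bad
  points has at most \<open>rank_on P (V j) Y\<close> points in \<open>Y\<close>, and at most as
  many outside.\<close>

lemma rank_on_bad_points_le:
  fixes \<F> :: "'a set set"
  assumes p: "prime p" and j: "j > 0" and a: "a > 0" "M = a * totient (p ^ a)"
    and \<Omega>: "finite \<Omega>" "\<F> \<subseteq> Pow \<Omega>" and closed: "closed_mod (2 * j * M) (p ^ a) \<F>"
    and rank: "rank_on (int p) (inter_span \<F> (3 * j)) \<Omega> \<le> rank_on (int p) (inter_span \<F> j) \<Omega> + d"
  shows "rank_on (int p) (inter_span \<F> j) (bad_points \<F> (p ^ a)) \<le> 4 * d"
proof -
  define P where "P = int p"
  define V where "V = inter_span \<F>"
  have P: "prime P" "P > 1" using p prime_gt_1_nat[OF p] by (auto simp: P_def)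
  have VG: "additive_group (V k)" for k unfolding V_def by (rule additive_group_inter_span)
  have Vmono: "V j \<subseteq> V k" if "j \<le> k" for j k using that unfolding V_def by (rule inter_span_mono)
  have Vmult: "(\<lambda>x. f x * g x) \<in> V (i + k)" if "f \<in> V i" "g \<in> V k" for f g i k
    using that unfolding V_def by (rule inter_span_mult)
  have Vcong: "f x = f y" if "f \<in> V k" "\<And>F. F \<in> \<F> \<Longrightarrow> x \<in> F \<longleftrightarrow> y \<in> F" for f x y k
    using that unfolding V_def by (rule inter_span_cong)
  obtain I where I: "I \<subseteq> \<Omega>" "indep_mod P (V j) I" "card I = rank_on P (V j) \<Omega>"
    and I_max: "\<And>g y. \<lbrakk>g \<in> V j; \<forall>i\<in>I. P dvd g i; y \<in> \<Omega>\<rbrakk> \<Longrightarrow> P dvd g y"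
    by (rule maximal_indep_mod[OF P(1) VG \<Omega>(1), of j]) (rule that)
  have "finite I" using I(1) \<Omega>(1) finite_subset by blast
  have "\<forall>i\<in>I. \<exists>g\<in>V j. [g i = 1] (mod P) \<and> (\<forall>k\<in>I - {i}. P dvd g k)"
    using I(2) unfolding indep_mod_def .
  then obtain g where g: "\<And>i. i \<in> I \<Longrightarrow> g i \<in> V j" "\<And>i. i \<in> I \<Longrightarrow> [g i i = 1] (mod P)"
    "\<And>i k. i \<in> I \<Longrightarrow> k \<in> I \<Longrightarrow> k \<noteq> i \<Longrightarrow> P dvd g i k"
    by (metis DiffI singletonD)
  define N where "N = {f \<in> V (2 * j). \<forall>i\<in>I. P dvd f i}"
  define Y where "Y = {y\<in>\<Omega>. \<exists>f\<in>N. \<not> P dvd f y}"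
  have "finite Y" "Y \<subseteq> \<Omega>" using \<Omega>(1) by (auto simp: Y_def)
  have "additive_group N"
    using VG[of "2 * j"] by (auto simp: N_def additive_group_def)
  have "rank_on P (V j) Y \<le> 2 * d"
    unfolding Y_def
  proof (rule rank_on_support_le[OF P(1) VG VG \<open>additive_group N\<close> \<Omega>(1) Vmono I(1,2)])
    show "rank_on P (V (3 * j)) \<Omega> \<le> card I + d" using rank I(3) by (simp add: V_def P_def)
    show "(\<lambda>x. f x * g x) \<in> V (3 * j)" if "f \<in> N" "g \<in> V j" for f g
      using Vmult[of f "2 * j" g j] that by (simp add: N_def)
  qed (auto simp: N_def)
  have dvd_N: "P dvd f y" if "f \<in> N" "y \<in> \<Omega> - Y" for f y using that by (auto simp: Y_def)
  \<comment> \<open>At each point of \<open>I\<close> one factor is divisible by \<open>P\<close>,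
    so the product lies in \<open>N\<close> and is divisible off \<open>Y\<close>;
    \<open>idem\<close> argues likewise with \<open>g i * g i - g i\<close>.\<close>
  have ortho: "P dvd g i y * g k y" if "i \<in> I" "k \<in> I" "i \<noteq> k" "y \<in> \<Omega> - Y" for i k y
  proof (rule dvd_N[OF _ that(4)])
    have "P dvd g i l * g k l" if "l \<in> I" for l
      using g(3)[of i l] g(3)[of k l] \<open>i \<in> I\<close> \<open>k \<in> I\<close> \<open>i \<noteq> k\<close> that by (cases "l = i") auto
    then show "(\<lambda>y. g i y * g k y) \<in> N"
      using Vmult[OF g(1) g(1)] that by (simp add: N_def mult_2)
  qed
  have idem: "[g i y = 1] (mod P)" if "i \<in> I" "y \<in> \<Omega> - Y" "\<not> P dvd g i y" for i y
  proof -
    have "P dvd g i l * (g i l - 1)" if "l \<in> I" for l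
      using g(2)[of i] g(3)[of i l] \<open>i \<in> I\<close> that by (cases "l = i") (auto simp: cong_iff_dvd_diff)
    moreover have "(\<lambda>y. g i y * g i y - g i y) \<in> V (2 * j)"
      using Vmult[OF g(1) g(1), OF that(1,1)] g(1)[OF that(1)] Vmono[of j "2 * j"]
      by (intro additive_group_diff[OF VG]) (auto simp: mult_2)
    ultimately have "(\<lambda>y. g i y * g i y - g i y) \<in> N" by (simp add: N_def algebra_simps)
    then have "P dvd g i y * (g i y - 1)" using dvd_N that(2) by (fastforce simp: algebra_simps)
    then show ?thesis using that(3) P(1) by (simp add: prime_dvd_mult_iff cong_iff_dvd_diff)
  qed
  \<comment> \<open>Interpolation: both sides agree modulo \<open>P\<close> on \<open>I\<close>,
    hence on \<open>\<Omega>\<close> by \<open>I_max\<close>.\<close>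
  have expand: "[of_bool (y \<in> F) = (\<Sum>i\<in>I \<inter> F. g i y)] (mod P)"
    if "F \<in> \<F>" "y \<in> \<Omega>" for F y
  proof -
    have "(\<lambda>y. of_bool (y \<in> F) - (\<Sum>i\<in>I \<inter> F. g i y)) \<in> V j"
      using g(1) inter_span_member[OF that(1)] Vmono[of 1 j] j unfolding V_def
      by (intro additive_group_diff[OF additive_group_inter_span]
          additive_group_sum[OF additive_group_inter_span]) auto
    moreover have "[of_bool (l \<in> F) = (\<Sum>i\<in>I \<inter> F. g i l)] (mod P)" if "l \<in> I" for l
    proof -
      have "[(\<Sum>i\<in>I \<inter> F. g i l) = (\<Sum>i\<in>I \<inter> F. of_bool (i = l))] (mod P)"
        using g(2,3) that by (intro cong_sum) (auto simp: cong_0_iff)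
      also have "(\<Sum>i\<in>I \<inter> F. of_bool (i = l)) = (of_bool (l \<in> F) :: int)"
        using that \<open>finite I\<close> by (auto simp: of_bool_def)
      finally show ?thesis by (rule cong_sym)
    qed
    ultimately have "P dvd of_bool (y \<in> F) - (\<Sum>i\<in>I \<inter> F. g i y)"
      using that(2) by (intro I_max) (auto simp: cong_iff_dvd_diff)
    then show ?thesis by (simp add: cong_iff_dvd_diff)
  qed
  \<comment> \<open>By \<open>ortho\<close> and \<open>idem\<close> only \<open>g i\<close> survives
    at \<open>x\<close>, with value 1, so the expansion of \<open>F\<close> at \<open>x\<close>
    reads off whether \<open>i\<close> lies in \<open>F\<close>.\<close>
  have member: "x \<in> F \<longleftrightarrow> i \<in> F"
    if "F \<in> \<F>" "x \<in> \<Omega> - Y" "i \<in> I" "\<not> P dvd g i x" for F x i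
  proof -
    have "[g k x = of_bool (k = i)] (mod P)" if "k \<in> I" for k
      using ortho[of k i x] idem[of i x] \<open>x \<in> \<Omega> - Y\<close> \<open>i \<in> I\<close> \<open>\<not> P dvd g i x\<close> that P(1)
      by (auto simp: prime_dvd_mult_iff cong_0_iff)
    then have "[(\<Sum>k\<in>I \<inter> F. g k x) = (\<Sum>k\<in>I \<inter> F. of_bool (k = i))] (mod P)"
      by (intro cong_sum) auto
    also have "(\<Sum>k\<in>I \<inter> F. of_bool (k = i)) = (of_bool (i \<in> F) :: int)"
      using that \<open>finite I\<close> by (auto simp: of_bool_def)
    finally have "[of_bool (x \<in> F) = (of_bool (i \<in> F) :: int)] (mod P)"
      using expand[OF that(1)] that(2) cong_trans by blast
    then show ?thesis using P(2) by (auto simp: of_bool_def cong_def split: if_splits)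
  qed
  \<comment> \<open>Otherwise the expansion of a member through \<open>x\<close> would give 1 = 0
    modulo \<open>P\<close>.\<close>
  have rep: "\<exists>i\<in>I. \<not> P dvd g i x" if x: "x \<in> \<Omega> - Y" "x \<in> \<Union>\<F>" for x
  proof (rule ccontr)
    assume "\<not> ?thesis"
    then have "P dvd (\<Sum>i\<in>I \<inter> F. g i x)" for F by (intro dvd_sum) auto
    moreover obtain F where "F \<in> \<F>" "x \<in> F" using x(2) by blast
    moreover from this have "[1 = (\<Sum>i\<in>I \<inter> F. g i x)] (mod P)"
      using expand[of F x] x(1) by simp
    ultimately have "P dvd 1" by (metis cong_dvd_iff)
    then show False using P(1) by (simp add: not_prime_unit)
  qed
  let ?B = "bad_points \<F> (p ^ a)"
  have "?B \<subseteq> \<Omega>" using \<Omega>(2) by (auto simp: bad_points_def)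
  then have "finite ?B" using \<Omega>(1) finite_subset by blast
  obtain J where J: "J \<subseteq> ?B" "indep_mod P (V j) J" "card J = rank_on P (V j) ?B"
    by (rule maximal_indep_mod[OF P(1) VG \<open>finite ?B\<close>, of j])
  have "finite J" using J(1) \<open>finite ?B\<close> finite_subset by blast
  \<comment> \<open>Functions of \<open>V j\<close> agree at points lying in the same members, yet a
    dual function separates \<open>x\<close> from \<open>y\<close>.\<close>
  have sep: "\<exists>F\<in>\<F>. \<not> (x \<in> F \<longleftrightarrow> y \<in> F)" if xy: "x \<in> J" "y \<in> J" "x \<noteq> y" for x y
  proof (rule ccontr)
    assume *: "\<not> ?thesis"
    obtain f where f: "f \<in> V j" "[f x = 1] (mod P)" "P dvd f y"
      using J(2) xy unfolding indep_mod_def by blast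
    have "f x = f y" using * by (intro Vcong[OF f(1)]) auto
    then show False using f P(1) by (metis cong_dvd_iff not_prime_unit)
  qed
  \<comment> \<open>Vanishing modulo \<open>P\<close> on \<open>Y\<close> amounts to vanishing on
    the \<open>rank_on P (V j) Y\<close> points of \<open>K\<close>. With more points in
    \<open>J - Y\<close> than that, some nontrivial combination \<open>H\<close> of the
    \<open>g (\<iota> x)\<close> vanishes on \<open>Y\<close>.\<close>
  have "card (J - Y) \<le> rank_on P (V j) Y"
  proof (rule ccontr)
    assume "\<not> ?thesis"
    obtain K where K: "K \<subseteq> Y" "card K = rank_on P (V j) Y"
      and K_max: "\<And>g y. \<lbrakk>g \<in> V j; \<forall>i\<in>K. P dvd g i; y \<in> Y\<rbrakk> \<Longrightarrow> P dvd g y"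
      by (rule maximal_indep_mod[OF P(1) VG \<open>finite Y\<close>, of j]) (rule that)
    have "finite K" using K(1) \<open>finite Y\<close> finite_subset by blast
    have "\<forall>x\<in>J - Y. \<exists>i\<in>I. \<not> P dvd g i x"
    proof
      fix x assume "x \<in> J - Y"
      then have "x \<in> \<Omega> - Y" "x \<in> \<Union>\<F>" using J(1) \<open>?B \<subseteq> \<Omega>\<close> by (auto simp: bad_points_def)
      then show "\<exists>i\<in>I. \<not> P dvd g i x" by (rule rep)
    qed
    then obtain \<iota> where \<iota>: "\<And>x. x \<in> J - Y \<Longrightarrow> \<iota> x \<in> I" "\<And>x. x \<in> J - Y \<Longrightarrow> \<not> P dvd g (\<iota> x) x"
      by metis
    have same: "x \<in> F \<longleftrightarrow> y \<in> F"
      if "x \<in> J - Y" "y \<in> \<Omega> - Y" "\<not> P dvd g (\<iota> x) y" "F \<in> \<F>" for x y F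
      using member[OF that(4) _ \<iota>(1)[OF that(1)]] \<iota>(2)[OF that(1)] that J(1) \<open>?B \<subseteq> \<Omega>\<close>
      by blast
    have "card K < card (J - Y)" using K(2) \<open>\<not> card (J - Y) \<le> _\<close> by simp
    then obtain c x0 where x0: "x0 \<in> J - Y" "\<not> P dvd c x0"
      and c: "\<And>y. y \<in> K \<Longrightarrow> P dvd (\<Sum>x\<in>J - Y. c x * g (\<iota> x) y)"
      using exists_dependent_combination[of P "J - Y" K "\<lambda>x. g (\<iota> x)"] P(2) \<open>finite J\<close> \<open>finite K\<close>
      by blast
    define H where "H y = (\<Sum>x\<in>J - Y. c x * g (\<iota> x) y)" for y
    have H: "H \<in> V j"
      unfolding H_def by (intro additive_group_sum[OF VG] additive_group_scale[OF VG] g(1) \<iota>(1))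
    have H_Y: "P dvd H y" if "y \<in> Y" for y
      using K_max[OF H _ that] c by (simp add: H_def)
    \<comment> \<open>\<open>H\<close> kills \<open>Y\<close>, and off \<open>Y\<close> the factor
      \<open>g (\<iota> x0)\<close> is nonzero only at points lying in the same members as
      \<open>x0\<close>.\<close>
    define u where "u y = g (\<iota> x0) y * H y" for y
    have u: "u \<in> V (j + j)"
      unfolding u_def using Vmult[OF g(1)[OF \<iota>(1)[OF x0(1)]] H] .
    have "\<not> P dvd u x0"
    proof -
      \<comment> \<open>A nonzero value would put \<open>x\<close> and \<open>x0\<close> in the same
        members, contradicting \<open>sep\<close>.\<close>
      have "P dvd g (\<iota> x) x0" if "x \<in> J - Y - {x0}" for x
        using same[of x x0] sep[of x x0] x0(1) that J(1) \<open>?B \<subseteq> \<Omega>\<close> by blast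
      then have "P dvd (\<Sum>x\<in>J - Y - {x0}. c x * g (\<iota> x) x0)"
        by (intro dvd_sum dvd_mult) auto
      moreover have "H x0 = c x0 * g (\<iota> x0) x0 + (\<Sum>x\<in>J - Y - {x0}. c x * g (\<iota> x) x0)"
        unfolding H_def using x0(1) \<open>finite J\<close> by (intro sum.remove) auto
      moreover have "\<not> P dvd c x0 * g (\<iota> x0) x0"
        using x0 \<iota>(2) P(1) by (simp add: prime_dvd_mult_iff)
      ultimately have "\<not> P dvd H x0" by (metis dvd_add_left_iff)
      then show ?thesis using x0 \<iota>(2) P(1) by (simp add: u_def prime_dvd_mult_iff)
    qed
    have "{y \<in> \<Omega>. \<not> P dvd u y} = atom \<F> x0"
    proof (intro equalityI subsetI)
      fix y assume y: "y \<in> {y \<in> \<Omega>. \<not> P dvd u y}"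
      then have "\<not> P dvd g (\<iota> x0) y" "\<not> P dvd H y" by (auto simp: u_def)
      then have "y \<in> \<Omega> - Y" using y H_Y by blast
      then have "\<forall>F\<in>\<F>. x0 \<in> F \<longleftrightarrow> y \<in> F"
        using same[OF x0(1)] \<open>\<not> P dvd g (\<iota> x0) y\<close> by blast
      moreover have "x0 \<in> \<Union>\<F>" using x0(1) J(1) by (auto simp: bad_points_def)
      ultimately show "y \<in> atom \<F> x0" by (auto simp: atom_def)
    next
      fix y assume y: "y \<in> atom \<F> x0"
      then have "u x0 = u y" by (intro Vcong[OF u]) (auto simp: atom_def)
      moreover have "y \<in> \<Omega>" using y \<Omega>(2) by (auto simp: atom_def)
      ultimately show "y \<in> {y \<in> \<Omega>. \<not> P dvd u y}" using \<open>\<not> P dvd u x0\<close> by simp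
    qed
    moreover have "[(\<Sum>y\<in>\<Omega>. u y ^ M) = (\<Sum>y\<in>\<Omega>. of_bool (\<not> P dvd u y))] (mod int p ^ a)"
      unfolding P_def by (intro cong_sum power_totient_cong p a)
    moreover have "(\<Sum>y\<in>\<Omega>. of_bool (\<not> P dvd u y)) = int (card {y \<in> \<Omega>. \<not> P dvd u y})"
      using \<Omega>(1) by (simp add: of_bool_def sum.If_cases Int_def)
    \<comment> \<open>\<open>u\<close> has degree \<open>2 * j\<close>, so its power has exactly the
      degree \<open>2 * j * M\<close> covered by closedness.\<close>
    moreover have "int (p ^ a) dvd (\<Sum>y\<in>\<Omega>. u y ^ M)"
    proof (rule closed_mod_dvd_sum[OF closed \<Omega>(2,1)])
      have "M > 0" using a p prime_gt_0_nat[of p] by simp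
      then show "(\<lambda>y. u y ^ M) \<in> inter_span \<F> (2 * j * M)"
        using inter_span_power[of u \<F> "j + j" M] u by (simp add: V_def mult_2)
    qed
    ultimately have "int (p ^ a) dvd int (card (atom \<F> x0))" by (simp add: cong_dvd_iff)
    then have "p ^ a dvd card (atom \<F> x0)" by (simp only: int_dvd_int_iff)
    then show False using x0(1) J(1) by (auto simp: bad_points_def)
  qed
  moreover have "card (J \<inter> Y) \<le> rank_on P (V j) Y"
    by (rule card_le_rank_on[OF \<open>finite Y\<close> Int_lower2 indep_mod_subset[OF J(2) Int_lower1 order_refl]])
  moreover have "card J = card (J \<inter> Y) + card (J - Y)"
    using card_Int_Diff[OF \<open>finite J\<close>] .
  ultimately show ?thesis using J(3) \<open>rank_on P (V j) Y \<le> 2 * d\<close> by (simp add: V_def P_def)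
qed

section \<open>Choosing the degree by pigeonhole\<close>

lemma rank_on_le_card:
  assumes "prime p" "additive_group V" "finite T"
  shows "rank_on p V T \<le> card T"
  using maximal_indep_mod[OF assms] by (metis assms(3) card_mono)

lemma card_projection_bad_points_le:
  assumes p: "prime p" and "a > 0" and "\<epsilon> > (0::real)"
  shows "\<exists>k>0. \<forall>(\<Omega>::'a set) \<F>. finite \<Omega> \<longrightarrow> \<F> \<subseteq> Pow \<Omega> \<longrightarrow> closed_mod k (p ^ a) \<F> \<longrightarrow>
    real (card (projection \<F> (bad_points \<F> (p ^ a)))) \<le> 2 powr (\<epsilon> * real (card \<Omega>))"
proof -
  define M where "M = a * totient (p ^ a)"
  define T where "T = Suc (nat \<lceil>4 / \<epsilon>\<rceil>)"
  have P: "prime (int p)" using p by simp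
  have "M > 0" using \<open>a > 0\<close> p prime_gt_0_nat[of p] by (simp add: M_def)
  have "real T \<ge> 4 / \<epsilon>" unfolding T_def by linarith
  then have T: "T > 0" "real T * \<epsilon> \<ge> 4"
    using \<open>\<epsilon> > 0\<close> by (auto simp: T_def field_simps)
  show ?thesis
  \<comment> \<open>This covers the closedness needed at every degree \<open>3 ^ i\<close> with
    \<open>i < T\<close>, whichever the pigeonhole selects.\<close>
  proof (intro exI[of _ "2 * 3 ^ T * M"] conjI allI impI)
    show "2 * 3 ^ T * M > 0" using \<open>M > 0\<close> by simp
    fix \<Omega> :: "'a set" and \<F>
    assume \<Omega>: "finite \<Omega>" "\<F> \<subseteq> Pow \<Omega>" and closed: "closed_mod (2 * 3 ^ T * M) (p ^ a) \<F>"
    \<comment> \<open>\<open>4 * d\<close> is at most \<open>\<epsilon> * card \<Omega>\<close>, as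
      the final bound requires, while \<open>T\<close> increments of at least \<open>d + 1\<close>
      would exceed \<open>card \<Omega>\<close>.\<close>
    define d where "d = nat \<lfloor>\<epsilon> * real (card \<Omega>) / 4\<rfloor>"
    have nonneg: "0 \<le> \<epsilon> * real (card \<Omega>) / 4" using \<open>\<epsilon> > 0\<close> by simp
    have d: "4 * real d \<le> \<epsilon> * real (card \<Omega>)" using of_nat_floor[OF nonneg] by (simp add: d_def)
    have d': "\<epsilon> * real (card \<Omega>) / 4 < real d + 1" using nonneg unfolding d_def by linarith
    define r where "r i = rank_on (int p) (inter_span \<F> (3 ^ i)) \<Omega>" for i
    have "\<exists>i<T. r (Suc i) \<le> r i + d"
    proof (rule ccontr)
      assume *: "\<not> ?thesis"
      have "i \<le> T \<Longrightarrow> i * (d + 1) \<le> r i" for i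
      proof (induction i)
        case (Suc i)
        then have "i * (d + 1) \<le> r i" "\<not> r (Suc i) \<le> r i + d" using * by auto
        then show ?case by simp
      qed simp
      from this[of T] have "T * (d + 1) \<le> card \<Omega>"
        using rank_on_le_card[OF P additive_group_inter_span \<Omega>(1), of \<F> "3 ^ T"] by (simp add: r_def)
      then have "real T * (real d + 1) \<le> real (card \<Omega>)"
        by (metis of_nat_1 of_nat_add of_nat_le_iff of_nat_mult)
      moreover have "real T * (\<epsilon> * real (card \<Omega>) / 4) < real T * (real d + 1)"
        using T(1) d' by (intro mult_strict_left_mono) auto
      moreover have "4 * real (card \<Omega>) \<le> real T * \<epsilon> * real (card \<Omega>)"
        using T(2) by (intro mult_right_mono) auto
      ultimately show False by simp
    qed
    then obtain i where i: "i < T" "r (Suc i) \<le> r i + d" by blast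
    let ?B = "bad_points \<F> (p ^ a)"
    have "closed_mod (2 * 3 ^ i * M) (p ^ a) \<F>"
      using i(1) \<open>M > 0\<close> by (intro closed_mod_mono[OF closed]) (auto intro!: power_increasing)
    then have "rank_on (int p) (inter_span \<F> (3 ^ i)) ?B \<le> 4 * d"
      using i(2) \<Omega> \<open>a > 0\<close> by (intro rank_on_bad_points_le[OF p]) (auto simp: M_def r_def)
    moreover have "?B \<subseteq> \<Omega>" using \<Omega>(2) by (auto simp: bad_points_def)
    then have "finite ?B" using \<Omega>(1) finite_subset by blast
    then have "rank_on (int p) (inter_span \<F> 1) ?B \<le> rank_on (int p) (inter_span \<F> (3 ^ i)) ?B"
      by (intro rank_on_mono inter_span_mono) auto
    ultimately have "(2::nat) ^ rank_on (int p) (inter_span \<F> 1) ?B \<le> 2 ^ (4 * d)"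
      by (intro power_increasing) auto
    then have "card (projection \<F> ?B) \<le> 2 ^ (4 * d)"
      using card_projection_le[OF P \<open>finite ?B\<close>, of \<F>] by linarith
    then have "real (card (projection \<F> ?B)) \<le> 2 ^ (4 * d)"
      by (metis of_nat_le_iff of_nat_numeral of_nat_power)
    also have "\<dots> = 2 powr (4 * real d)" by (simp flip: powr_realpow)
    also have "\<dots> \<le> 2 powr (\<epsilon> * real (card \<Omega>))" using d by (intro powr_mono) auto
    finally show "real (card (projection \<F> ?B)) \<le> 2 powr (\<epsilon> * real (card \<Omega>))" .
  qed
qed

section \<open>Traces on unions\<close>

lemma projection_image: "projection \<F> X = (\<lambda>F. F \<inter> X) ` \<F>"
  by (auto simp: projection_def)

lemma card_projection_Un_le:
  assumes "finite \<F>"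
  shows "card (projection \<F> (A \<union> B)) \<le> card (projection \<F> A) * card (projection \<F> B)"
proof -
  have "inj_on (\<lambda>C. (C \<inter> A, C \<inter> B)) (projection \<F> (A \<union> B))"
    by (rule inj_onI) (auto simp: projection_def)
  moreover have "(\<lambda>C. (C \<inter> A, C \<inter> B)) ` projection \<F> (A \<union> B) \<subseteq> projection \<F> A \<times> projection \<F> B"
    by (fastforce simp: projection_def)
  ultimately have "card (projection \<F> (A \<union> B)) \<le> card (projection \<F> A \<times> projection \<F> B)"
    using assms by (intro card_inj_on_le) (auto simp: projection_image)
  then show ?thesis by (simp add: card_cartesian_product)
qed

lemma card_projection_UN_le:
  assumes "finite \<F>" "finite S" "\<And>s. s \<in> S \<Longrightarrow> real (card (projection \<F> (B s))) \<le> c"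
  shows "real (card (projection \<F> (\<Union>s\<in>S. B s))) \<le> c ^ card S"
  using assms(2,3)
proof (induction S)
  case empty
  have "projection \<F> {} \<subseteq> {{}}" by (auto simp: projection_def)
  then have "card (projection \<F> {}) \<le> card {{} :: 'a set}" by (intro card_mono) auto
  then show ?case by simp
next
  case (insert s S)
  have "real (card (projection \<F> (\<Union>s\<in>insert s S. B s))) \<le>
      real (card (projection \<F> (B s))) * real (card (projection \<F> (\<Union>s\<in>S. B s)))"
    using card_projection_Un_le[OF assms(1), of "B s" "\<Union>s\<in>S. B s"] by (simp flip: of_nat_mult)
  also have "\<dots> \<le> c * c ^ card S"
    using insert order_trans[OF of_nat_0_le_iff insert(4)[of s]] by (intro mult_mono) auto
  finally show ?case using insert by simp
qed

section \<open>Cutting atoms into blocks\<close>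

text \<open>Induction: removing \<open>l\<close> points from a single fiber keeps all fiber sizes
  divisible by \<open>l\<close>.\<close>

lemma partition_fibers:
  assumes "finite X" "l > 0" "\<forall>x\<in>X. l dvd card {y\<in>X. f y = f x}"
  shows "\<exists>A. (\<forall>i\<in>{1..card X div l}. A i \<subseteq> X \<and> card (A i) = l) \<and>
    disjoint_family_on A {1..card X div l} \<and> X = (\<Union>i\<in>{1..card X div l}. A i) \<and>
    (\<forall>i\<in>{1..card X div l}. \<forall>x\<in>A i. \<forall>y\<in>A i. f x = f y)"
  using assms(1,3)
proof (induction X rule: finite_psubset_induct)
  case (psubset X)
  show ?case
  proof (cases "X = {}")
    case False
    then obtain x0 where "x0 \<in> X" by blast
    let ?C = "{y\<in>X. f y = f x0}"
    have "card ?C > 0" using \<open>x0 \<in> X\<close> \<open>finite X\<close> by (auto simp: card_gt_0_iff)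
    have dvd_C: "l dvd card ?C" using psubset(3) \<open>x0 \<in> X\<close> by blast
    with \<open>card ?C > 0\<close> have "l \<le> card ?C" by (simp add: dvd_imp_le)
    then obtain D where D: "D \<subseteq> ?C" "card D = l" "finite D" by (rule obtain_subset_with_card_n)
    have "D \<noteq> {}" using D(2) \<open>l > 0\<close> by auto
    have "l dvd card {y\<in>X - D. f y = f x}" if "x \<in> X - D" for x
    proof (cases "f x = f x0")
      case True
      then have "{y\<in>X - D. f y = f x} = ?C - D" by auto
      then show ?thesis
        using D dvd_C by (simp add: card_Diff_subset dvd_diff_nat)
    next
      case False
      then have "{y\<in>X - D. f y = f x} = {y\<in>X. f y = f x}" using D(1) by auto
      then show ?thesis using psubset(3) that by simp
    qed
    then have dvd: "\<forall>x\<in>X - D. l dvd card {y\<in>X - D. f y = f x}" by blast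
    have "X - D \<subset> X" using D(1) \<open>D \<noteq> {}\<close> by blast
    from psubset(2)[OF this dvd] obtain A where A: "\<forall>i\<in>{1..card (X - D) div l}. A i \<subseteq> X - D \<and> card (A i) = l"
      "disjoint_family_on A {1..card (X - D) div l}" "X - D = (\<Union>i\<in>{1..card (X - D) div l}. A i)"
      "\<forall>i\<in>{1..card (X - D) div l}. \<forall>x\<in>A i. \<forall>y\<in>A i. f x = f y"
      by (elim exE conjE) (rule that)
    define m where "m = card (X - D) div l"
    have "D \<subseteq> X" using D(1) by blast
    then have "card X = l + card (X - D)"
      using D \<open>finite X\<close> card_mono[OF \<open>finite X\<close> \<open>D \<subseteq> X\<close>] by (simp add: card_Diff_subset)
    then have m: "card X div l = Suc m" using \<open>l > 0\<close> by (simp add: m_def)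
    have set: "{1..Suc m} = insert (Suc m) {1..m}" by auto
    define A' where "A' = A(Suc m := D)"
    have A': "A' (Suc m) = D" "\<And>i. i \<in> {1..m} \<Longrightarrow> A' i = A i" by (auto simp: A'_def)
    note A = A[folded m_def]
    show ?thesis
      unfolding m set
    proof (intro exI[of _ A'] conjI)
      show "\<forall>i\<in>insert (Suc m) {1..m}. A' i \<subseteq> X \<and> card (A' i) = l"
        using A' A(1) D(2) \<open>D \<subseteq> X\<close> by auto
      have "disjoint_family_on A' {1..m}"
        using A(2) A'(2) by (simp add: disjoint_family_on_def)
      moreover have U: "(\<Union>i\<in>{1..m}. A' i) = X - D" using A(3) A'(2) by simp
      then have "A' (Suc m) \<inter> (\<Union>i\<in>{1..m}. A' i) = {}" using A'(1) by blast
      ultimately show "disjoint_family_on A' (insert (Suc m) {1..m})"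
        by (subst disjoint_family_on_insert) simp_all
      show "X = (\<Union>i\<in>insert (Suc m) {1..m}. A' i)" using U A'(1) \<open>D \<subseteq> X\<close> by auto
      show "\<forall>i\<in>insert (Suc m) {1..m}. \<forall>x\<in>A' i. \<forall>y\<in>A' i. f x = f y"
      proof (intro ballI)
        fix i x y assume i: "i \<in> insert (Suc m) {1..m}" and xy: "x \<in> A' i" "y \<in> A' i"
        show "f x = f y"
        proof (cases "i = Suc m")
          case True
          then have "f x = f x0" "f y = f x0" using xy A'(1) D(1) by blast+
          then show ?thesis by simp
        next
          case False
          then have "i \<in> {1..m}" using i by blast
          then show ?thesis using xy A(4) A'(2) by blast
        qed
      qed
    qed
  qed (auto simp: disjoint_family_on_def)
qed

lemma atom_eq: "y \<in> atom \<F> x \<Longrightarrow> atom \<F> y = atom \<F> x"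
  by (auto simp: atom_def)

lemma dvd_if_prime_powers_dvd:
  fixes l m :: nat
  assumes "l > 0" "\<And>p. p \<in> prime_factors l \<Longrightarrow> p ^ multiplicity p l dvd m"
  shows "l dvd m"
proof (cases "m = 0")
  case False
  show ?thesis
  proof (rule multiplicity_le_imp_dvd)
    fix p :: nat assume "prime p"
    show "multiplicity p l \<le> multiplicity p m"
    proof (cases "p dvd l")
      case True
      then have "p \<in> prime_factors l" using \<open>prime p\<close> \<open>l > 0\<close> by (simp add: in_prime_factors_iff)
      then show ?thesis
        using assms(2) False \<open>prime p\<close> by (intro multiplicity_geI) (auto simp: not_prime_unit)
    qed (simp add: not_dvd_imp_multiplicity_0)
  qed (use \<open>l > 0\<close> in simp)
qed simp

text \<open>On \<open>X\<close> the atoms are the fibers of the map sending a point to the members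
  through it; a block inside a fiber is contained in or disjoint from each trace.\<close>

lemma projection_subset_isomorphic_copy:
  fixes \<F> :: "'a set set"
  assumes "finite X" "l > 0" "X \<subseteq> \<Union>\<F>"
    and atoms: "\<And>x. x \<in> X \<Longrightarrow> atom \<F> x \<subseteq> X \<and> l dvd card (atom \<F> x)"
  shows "\<exists>\<S> \<G>. is_S X l \<S> \<and> isomorphic_copy X \<S> \<G> \<and> projection \<F> X \<subseteq> \<G>"
proof -
  define f where "f x = {F\<in>\<F>. x \<in> F}" for x
  have "{y\<in>X. f y = f x} = atom \<F> x" if "x \<in> X" for x
    using atoms[OF that] \<open>X \<subseteq> \<Union>\<F>\<close> by (auto simp: f_def atom_def)
  then have "\<forall>x\<in>X. l dvd card {y\<in>X. f y = f x}" using atoms by simp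
  from partition_fibers[of X l f, OF assms(1,2) this] obtain A where
    A: "\<forall>i\<in>{1..card X div l}. A i \<subseteq> X \<and> card (A i) = l"
    "disjoint_family_on A {1..card X div l}" "X = (\<Union>i\<in>{1..card X div l}. A i)"
    "\<forall>i\<in>{1..card X div l}. \<forall>x\<in>A i. \<forall>y\<in>A i. f x = f y"
    by (elim exE conjE) (rule that)
  let ?S = "atomic_family X (card X div l) A"
  have "is_S X l ?S" using A(1,2) unfolding is_S_def by blast
  \<comment> \<open>\<open>is_S\<close> already admits any choice of blocks, so the identity
    permutation suffices.\<close>
  moreover have "isomorphic_copy X ?S ?S"
    unfolding isomorphic_copy_def by (intro exI[of _ id] conjI permutes_id) simp
  moreover have "projection \<F> X \<subseteq> ?S"
  proof
    fix G assume "G \<in> projection \<F> X"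
    then obtain F where F: "F \<in> \<F>" "G = F \<inter> X" by (auto simp: projection_def)
    have "A i \<subseteq> G \<or> A i \<inter> G = {}" if "i \<in> {1..card X div l}" for i
    proof (rule ccontr)
      assume "\<not> ?thesis"
      then obtain x y where "x \<in> A i" "x \<notin> G" "y \<in> A i" "y \<in> G" by blast
      moreover from this have "f x = f y" using A(4) that by blast
      ultimately show False using F A(1) that unfolding f_def by blast
    qed
    then show "G \<in> ?S" using F(2) A(3) unfolding atomic_family_def by blast
  qed
  ultimately show ?thesis by blast
qed

section \<open>Combining the prime powers dividing \<open>l\<close>\<close>

theorem theorem1p2:
  fixes \<epsilon> :: real and l :: nat
  assumes "\<epsilon> > 0" and "l > 0"
  shows "\<exists>k::nat. k > 0 \<and>
    (\<forall>n::nat. n > 0 \<longrightarrow>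
      (\<forall>\<F>::nat set set. \<F> \<subseteq> Pow {1..n} \<longrightarrow> closed_mod k l \<F> \<longrightarrow>
        (\<exists>X. X \<subseteq> {1..n} \<and>
          real (card (projection \<F> X)) \<ge> 2 powr (- \<epsilon> * real n) * real (card \<F>) \<and>
          (\<exists>\<S> \<G>. is_S X l \<S> \<and> isomorphic_copy X \<S> \<G> \<and> projection \<F> X \<subseteq> \<G>))))"
proof -
  let ?S = "prime_factors l"
  \<comment> \<open>The summand 1 avoids division by zero for \<open>l = 1\<close>, which has no
    prime factors.\<close>
  define \<delta> where "\<delta> = \<epsilon> / (card ?S + 1)"
  have \<delta>: "\<delta> > 0" "\<delta> * card ?S \<le> \<epsilon>"
    using \<open>\<epsilon> > 0\<close> by (auto simp: \<delta>_def field_simps)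
  have "\<forall>p\<in>?S. \<exists>k>0. \<forall>(\<Omega>::nat set) \<F>. finite \<Omega> \<longrightarrow> \<F> \<subseteq> Pow \<Omega> \<longrightarrow>
    closed_mod k (p ^ multiplicity p l) \<F> \<longrightarrow>
    real (card (projection \<F> (bad_points \<F> (p ^ multiplicity p l)))) \<le> 2 powr (\<delta> * real (card \<Omega>))"
  proof
    fix p assume "p \<in> ?S"
    then show "\<exists>k>0. \<forall>(\<Omega>::nat set) \<F>. finite \<Omega> \<longrightarrow> \<F> \<subseteq> Pow \<Omega> \<longrightarrow>
      closed_mod k (p ^ multiplicity p l) \<F> \<longrightarrow>
      real (card (projection \<F> (bad_points \<F> (p ^ multiplicity p l)))) \<le> 2 powr (\<delta> * real (card \<Omega>))"
      using \<delta>(1) by (intro card_projection_bad_points_le)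
        (auto simp: in_prime_factors_iff prime_multiplicity_gt_zero_iff)
  qed
  then obtain \<kappa> where \<kappa>: "\<And>p. p \<in> ?S \<Longrightarrow> \<kappa> p > 0"
    "\<And>p (\<Omega>::nat set) \<F>. \<lbrakk>p \<in> ?S; finite \<Omega>; \<F> \<subseteq> Pow \<Omega>; closed_mod (\<kappa> p) (p ^ multiplicity p l) \<F>\<rbrakk> \<Longrightarrow>
      real (card (projection \<F> (bad_points \<F> (p ^ multiplicity p l)))) \<le> 2 powr (\<delta> * real (card \<Omega>))"
    by metis
  \<comment> \<open>The sum dominates every \<open>\<kappa> p\<close>; \<open>Suc\<close> keeps
    \<open>k\<close> positive when \<open>l = 1\<close>.\<close>
  define k where "k = Suc (\<Sum>p\<in>?S. \<kappa> p)"
  have \<kappa>_le: "\<kappa> p \<le> k" if "p \<in> ?S" for p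
    unfolding k_def using member_le_sum[OF that, of \<kappa>] by simp
  show ?thesis
  proof (intro exI[of _ k] conjI allI impI)
    show "k > 0" by (simp add: k_def)
    fix n :: nat and \<F> :: "nat set set"
    assume "n > 0" and \<F>: "\<F> \<subseteq> Pow {1..n}" and closed: "closed_mod k l \<F>"
    have "finite \<F>" using \<F> finite_subset by blast
    define B where "B = (\<Union>p\<in>?S. bad_points \<F> (p ^ multiplicity p l))"
    define X where "X = \<Union>\<F> - B"
    have X: "X \<subseteq> {1..n}" using \<F> by (auto simp: X_def)
    have "real (card (projection \<F> (bad_points \<F> (p ^ multiplicity p l)))) \<le> 2 powr (\<delta> * real n)"
      if "p \<in> ?S" for p
      using \<kappa>(2)[OF that _ \<F> closed_mod_mono[OF closed \<kappa>_le[OF that] \<kappa>(1)[OF that]]]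
      by (simp add: multiplicity_dvd)
    then have "real (card (projection \<F> B)) \<le> (2 powr (\<delta> * real n)) ^ card ?S"
      unfolding B_def by (intro card_projection_UN_le \<open>finite \<F>\<close>) auto
    also have "\<dots> = 2 powr (\<delta> * card ?S * real n)"
      by (simp add: powr_powr mult_ac flip: powr_realpow)
    also have "\<dots> \<le> 2 powr (\<epsilon> * real n)"
      using \<delta>(2) by (intro powr_mono mult_right_mono) auto
    finally have B: "real (card (projection \<F> B)) \<le> 2 powr (\<epsilon> * real n)" .
    \<comment> \<open>Every member lies in \<open>X \<union> B\<close>, so it is determined by its
      traces on \<open>X\<close> and \<open>B\<close>; few traces on \<open>B\<close> leave many on
      \<open>X\<close>.\<close>
    have "F \<inter> (X \<union> B) = F" if "F \<in> \<F>" for F using that by (auto simp: X_def)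
    then have "projection \<F> (X \<union> B) = \<F>" by (simp add: projection_image)
    then have "real (card \<F>) \<le> real (card (projection \<F> X)) * real (card (projection \<F> B))"
      using card_projection_Un_le[OF \<open>finite \<F>\<close>, of X B] by (simp flip: of_nat_mult)
    also have "\<dots> \<le> real (card (projection \<F> X)) * 2 powr (\<epsilon> * real n)"
      using B by (intro mult_left_mono) auto
    finally have large: "2 powr (- \<epsilon> * real n) * real (card \<F>) \<le> real (card (projection \<F> X))"
      by (simp add: powr_minus field_simps)
    have "atom \<F> x \<subseteq> X \<and> l dvd card (atom \<F> x)" if "x \<in> X" for x
    proof
      have good: "p ^ multiplicity p l dvd card (atom \<F> x)" if "p \<in> ?S" for p
        using \<open>x \<in> X\<close> that by (auto simp: X_def B_def bad_points_def)
      then show "l dvd card (atom \<F> x)" using \<open>l > 0\<close> by (rule dvd_if_prime_powers_dvd[rotated])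
      show "atom \<F> x \<subseteq> X"
      proof
        fix y assume y: "y \<in> atom \<F> x"
        \<comment> \<open>Badness depends only on the atom, so deleting \<open>B\<close> removes
          whole atoms.\<close>
        then have "y \<notin> B" using good by (auto simp: B_def bad_points_def atom_eq)
        then show "y \<in> X" using y by (auto simp: X_def atom_def)
      qed
    qed
    moreover have "finite X" "X \<subseteq> \<Union>\<F>" using X finite_subset by (auto simp: X_def)
    ultimately have "\<exists>\<S> \<G>. is_S X l \<S> \<and> isomorphic_copy X \<S> \<G> \<and> projection \<F> X \<subseteq> \<G>"
      using \<open>l > 0\<close> by (intro projection_subset_isomorphic_copy) auto
    with X large show "\<exists>X. X \<subseteq> {1..n} \<and>
        real (card (projection \<F> X)) \<ge> 2 powr (- \<epsilon> * real n) * real (card \<F>) \<and>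
        (\<exists>\<S> \<G>. is_S X l \<S> \<and> isomorphic_copy X \<S> \<G> \<and> projection \<F> X \<subseteq> \<G>)"
      by blast
  qed
qed

end
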